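(* Let $\mathcal{A}$ be a real line arrangement in $\mathbb{R}^2$. Then $d_f(\mathcal{A})\geq\nu_\infty(\mathcal{A})$, where $\nu_\infty(\mathcal{A})=\max\{m(\mathcal{A})-1,\,p(\mathcal{A})\}$.
   Context: A real line arrangement is a finite nonempty set $\mathcal{A}$ of distinct (affine) lines in $\mathbb{R}^2$. A polynomial vector field is $\chi=P\partial_x+Q\partial_y$ with $P,Q\in\mathbb{R}[x,y]$; its degree is $\max\{\deg P,\deg Q\}$. For a line $L$ with degree-one equation $\alpha_L=0$, $L$ is invariant by (fixed by) $\chi$ if it is invariant under the flow of $\chi$, equivalently if $\alpha_L$ divides $\chi\alpha_L$ in $\mathbb{R}[x,y]$. $\mathcal{D}(\mathcal{A})$ is the set of polynomial vector fields $\chi$ with $\chi\mathcal{Q}_{\mathcal{A}}\in(\mathcal{Q}_{\mathcal{A}})$, where $\mathcal{Q}_{\mathcal{A}}=\prod_{L\in\mathcal{A}}\alpha_L$; equivalently, the set of $\chi$ for which every line of $\mathcal{A}$ is invariant. $d_f(\mathcal{A})$ is the minimal degree of an element $\chi\in\mathcal{D}(\mathcal{A})$ such that only finitely many lines of $\mathbb{R}^2$ are invariant by $\chi$. $m(\mathcal{A})$ is the maximal multiplicity of the singular points of $\mathcal{A}$: a singular point is a point lying on at least two lines of $\mathcal{A}$, its multiplicity is the number of lines of $\mathcal{A}$ containing it, and $m(\mathcal{A})=1$ if there is no singular point. $p(\mathcal{A})$ is the maximal cardinality of a subset of $\mathcal{A}$ consisting of mutually parallel lines (so $p(\mathcal{A})=1$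 if no two lines are parallel). *)

theory Defs
  imports "HOL-Analysis.Analysis" "HOL-Computational_Algebra.Computational_Algebra"
begin

unbundle no fps_syntax

text \<open>
  A polynomial in \<open>\<real>[x, y] = \<real>[x][y]\<close> has type \<^typ>\<open>real poly poly\<close>: the outer indeterminate
  is \<open>y\<close>, and \<open>coeff (coeff p j) i\<close> is the coefficient of \<open>x ^ i * y ^ j\<close>.
\<close>

type_synonym poly2 = "real poly poly"

definition eval2 :: "poly2 \<Rightarrow> real ^ 2 \<Rightarrow> real" where
  "eval2 p v = poly (poly p [:v $ 2:]) (v $ 1)"

definition partial_x :: "poly2 \<Rightarrow> poly2" where
  "partial_x p = map_poly pderiv p"

definition partial_y :: "poly2 \<Rightarrow> poly2" where
  "partial_y p = pderiv p"

text \<open>As for \<^const>\<open>degree\<close>, the zero polynomial gets total degree 0.\<close>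

definition total_degree :: "poly2 \<Rightarrow> nat" where
  "total_degree p = Max (insert 0 {i + j |i j. coeff (coeff p j) i \<noteq> 0})"

text \<open>The pair \<open>(P, Q)\<close> stands for the vector field \<open>P \<partial>\<^sub>x + Q \<partial>\<^sub>y\<close>.\<close>

type_synonym vector_field = "poly2 \<times> poly2"

definition vf_apply :: "vector_field \<Rightarrow> poly2 \<Rightarrow> poly2" where
  "vf_apply X f = fst X * partial_x f + snd X * partial_y f"

definition vf_degree :: "vector_field \<Rightarrow> nat" where
  "vf_degree X = max (total_degree (fst X)) (total_degree (snd X))"

definition is_line :: "(real ^ 2) set \<Rightarrow> bool" where
  "is_line L \<longleftrightarrow> affine L \<and> aff_dim L = 1"

definition is_line_equation :: "poly2 \<Rightarrow> (real ^ 2) set \<Rightarrow> bool" where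
  "is_line_equation \<alpha> L \<longleftrightarrow> total_degree \<alpha> = 1 \<and> L = {v. eval2 \<alpha> v = 0}"

text \<open>
  The equation of a line is unique only up to a nonzero real factor; such factors are
  units of \<open>\<real>[x, y]\<close>, so the divisibility conditions below do not depend on the choice.
\<close>

definition line_poly :: "(real ^ 2) set \<Rightarrow> poly2" where
  "line_poly L = (SOME \<alpha>. is_line_equation \<alpha> L)"

definition invariant_line :: "vector_field \<Rightarrow> (real ^ 2) set \<Rightarrow> bool" where
  "invariant_line X L \<longleftrightarrow> is_line L \<and> line_poly L dvd vf_apply X (line_poly L)"

definition line_arrangement :: "(real ^ 2) set set \<Rightarrow> bool" where
  "line_arrangement \<A> \<longleftrightarrow> finite \<A> \<and> \<A> \<noteq> {} \<and> (\<forall>L\<in>\<A>. is_line L)"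

definition defining_poly :: "(real ^ 2) set set \<Rightarrow> poly2" where
  "defining_poly \<A> = (\<Prod>L\<in>\<A>. line_poly L)"

definition derivations :: "(real ^ 2) set set \<Rightarrow> vector_field set" where
  "derivations \<A> = {X. defining_poly \<A> dvd vf_apply X (defining_poly \<A>)}"

definition d_f :: "(real ^ 2) set set \<Rightarrow> nat" where
  "d_f \<A> = (LEAST d. \<exists>X\<in>derivations \<A>. finite {L. invariant_line X L} \<and> vf_degree X = d)"

definition point_mult :: "(real ^ 2) set set \<Rightarrow> real ^ 2 \<Rightarrow> nat" where
  "point_mult \<A> v = card {L \<in> \<A>. v \<in> L}"

definition singular_points :: "(real ^ 2) set set \<Rightarrow> (real ^ 2) set" where
  "singular_points \<A> = {v. point_mult \<A> v \<ge> 2}"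

definition max_mult :: "(real ^ 2) set set \<Rightarrow> nat" where
  "max_mult \<A> =
    (if singular_points \<A> = {} then 1 else Max (point_mult \<A> ` singular_points \<A>))"

definition max_parallel :: "(real ^ 2) set set \<Rightarrow> nat" where
  "max_parallel \<A> = Max {card B |B. B \<subseteq> \<A> \<and> pairwise affine_parallel B}"

text \<open>The subtraction on \<^typ>\<open>nat\<close> does not truncate, since \<open>max_mult \<A> \<ge> 1\<close>.\<close>

definition nu_infinity :: "(real ^ 2) set set \<Rightarrow> nat" where
  "nu_infinity \<A> = max (max_mult \<A> - 1) (max_parallel \<A>)"

lemma is_line_equation_line_poly:
  assumes "is_line L"
  shows "is_line_equation (line_poly L) L"
proof -
  obtain a b where ab: "a \<noteq> 0" "L = {v. a \<bullet> v = b}"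
    using assms aff_dim_eq_hyperplane[of L] hull_same[of affine L]
    unfolding is_line_def by auto
  define \<alpha> :: poly2 where "\<alpha> = [:[:-b, a $ 1:], [:a $ 2:]:]"
  have ne: "a $ 1 \<noteq> 0 \<or> a $ 2 \<noteq> 0"
    using ab(1) by (auto simp: vec_eq_iff forall_2)
  have c: "coeff (coeff \<alpha> j) i =
      (if i = 0 \<and> j = 0 then -b else if i = 1 \<and> j = 0 then a $ 1
       else if i = 0 \<and> j = 1 then a $ 2 else 0)" for i j
    by (auto simp: \<alpha>_def coeff_pCons split: nat.split)
  let ?S = "{i + j |i j. coeff (coeff \<alpha> j) i \<noteq> 0}"
  have sub: "?S \<subseteq> {0, 1}" by (auto simp: c split: if_splits)
  moreover have "1 \<in> ?S"
  proof (cases "a $ 1 = 0")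
    case True
    with ne have "coeff (coeff \<alpha> 1) 0 \<noteq> 0" by (simp add: c)
    then show ?thesis by force
  next
    case False
    then have "coeff (coeff \<alpha> 0) 1 \<noteq> 0" by (simp add: c)
    then show ?thesis by force
  qed
  ultimately have "insert 0 ?S = {0, 1}" by blast
  then have "total_degree \<alpha> = 1" by (simp only: total_degree_def) simp
  moreover have "L = {v. eval2 \<alpha> v = 0}"
    by (auto simp: ab(2) eval2_def \<alpha>_def inner_vec_def sum_2 algebra_simps)
  ultimately have "is_line_equation \<alpha> L" by (simp add: is_line_equation_def)
  then show ?thesis unfolding line_poly_def by (rule someI)
qed

end

theory Submission
  imports Defs
begin

text \<open>
  Along each of its invariant lines a vector field is tangent to the line. If a field \<open>X\<close> of degree
  \<open>d\<close> fixes more than \<open>d\<close> parallel lines with normal \<open>n\<close>, then the polynomial \<open>n \<bullet> X\<close>, of degree at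
  most \<open>d\<close>, vanishes on all of them, hence identically, and every line with normal \<open>n\<close> is invariant.
  If \<open>X\<close> fixes more than \<open>d + 1\<close> lines through \<open>p\<close>, the same argument for the cross product of
  \<open>v - p\<close> and \<open>X v\<close>, of degree at most \<open>d + 1\<close>, shows that \<open>X\<close> is radial at \<open>p\<close> and that every line
  through \<open>p\<close> is invariant. So a field with finitely many invariant lines has degree at least
  \<open>nu_infinity\<close>; since \<^const>\<open>d_f\<close> is a \<open>LEAST\<close>, it also matters that such a field exists.
\<close>

no_notation fps_nth (infixl "$" 75)

section \<open>Evaluation, total degree and restriction to lines\<close>

lemma eval2_simps [simp]:
  "eval2 0 v = 0" "eval2 1 v = 1"
  "eval2 (f + g) v = eval2 f v + eval2 g v"
  "eval2 (f - g) v = eval2 f v - eval2 g v"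
  "eval2 (f * g) v = eval2 f v * eval2 g v"
  by (simp_all add: eval2_def)

lemma eval2_prod: "eval2 (\<Prod>i\<in>I. f i) v = (\<Prod>i\<in>I. eval2 (f i) v)"
  by (induction I rule: infinite_finite_induct) simp_all

lemma finite_total_degree_set:
  fixes p :: poly2
  shows "finite {i + j |i j. coeff (coeff p j) i \<noteq> 0}"
proof -
  let ?N = "Max ((\<lambda>j. degree (coeff p j)) ` {..degree p})"
  have "i \<le> ?N \<and> j \<le> degree p" if "coeff (coeff p j) i \<noteq> 0" for i j
  proof -
    have j: "j \<le> degree p"
      using that by (intro le_degree) auto
    have "i \<le> degree (coeff p j)"
      using that by (intro le_degree)
    also have "\<dots> \<le> ?N"
      using j by (intro Max_ge) auto
    finally show ?thesis
      using j by simp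
  qed
  then have "{i + j |i j. coeff (coeff p j) i \<noteq> 0} \<subseteq> {..?N + degree p}"
    by (fastforce intro: add_mono)
  then show ?thesis
    by (rule finite_subset) simp
qed

lemma total_degree_le_iff:
  "total_degree p \<le> n \<longleftrightarrow> (\<forall>i j. coeff (coeff p j) i \<noteq> 0 \<longrightarrow> i + j \<le> n)"
  unfolding total_degree_def
  using finite_total_degree_set[of p] by (subst Max_le_iff) auto

lemma le_total_degree: "coeff (coeff p j) i \<noteq> 0 \<Longrightarrow> i + j \<le> total_degree p"
  using total_degree_le_iff by blast

lemma total_degree_add_le:
  "total_degree p \<le> n \<Longrightarrow> total_degree q \<le> n \<Longrightarrow> total_degree (p + q) \<le> n"
  by (force simp: total_degree_le_iff)

lemma total_degree_diff_le:
  "total_degree p \<le> n \<Longrightarrow> total_degree q \<le> n \<Longrightarrow> total_degree (p - q) \<le> n"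
  by (force simp: total_degree_le_iff)

lemma total_degree_mult_le:
  assumes "total_degree p \<le> m" "total_degree q \<le> n"
  shows "total_degree (p * q) \<le> m + n"
  unfolding total_degree_le_iff
proof (intro allI impI)
  fix i j
  assume "coeff (coeff (p * q) j) i \<noteq> 0"
  then have "(\<Sum>l\<le>j. \<Sum>k\<le>i. coeff (coeff p l) k * coeff (coeff q (j - l)) (i - k)) \<noteq> 0"
    by (simp add: coeff_mult coeff_sum)
  then obtain l where l: "l \<le> j"
    and "(\<Sum>k\<le>i. coeff (coeff p l) k * coeff (coeff q (j - l)) (i - k)) \<noteq> 0"
    by (auto elim: sum.not_neutral_contains_not_neutral)
  then obtain k where k: "k \<le> i" and "coeff (coeff p l) k \<noteq> 0" "coeff (coeff q (j - l)) (i - k) \<noteq> 0"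
    by (auto elim: sum.not_neutral_contains_not_neutral)
  then have "k + l \<le> m" "(i - k) + (j - l) \<le> n"
    using assms unfolding total_degree_le_iff by blast+
  with k l show "i + j \<le> m + n"
    by linarith
qed

lemma total_degree_linear_le: "total_degree [:[:c, a:], [:b:]:] \<le> 1"
  by (auto simp: total_degree_le_iff coeff_pCons split: nat.splits)

lemma total_degree_const: "total_degree [:[:c:]:] = 0"
proof -
  have "total_degree [:[:c:]:] \<le> 0"
    unfolding total_degree_le_iff by (auto simp: coeff_pCons split: nat.splits)
  then show ?thesis
    by simp
qed

text \<open>Substituting the two affine coordinate functions of the line for x and y sends a
  monomial of total degree k to a univariate polynomial of degree at most k.\<close>

lemma eval2_along_line:
  obtains q where "\<And>t. poly q t = eval2 f (p + t *\<^sub>R u)" "degree q \<le> total_degree f"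
proof
  define q where
    "q = (\<Sum>j\<le>degree f. pcompose (coeff f j) [:p $ 1, u $ 1:] * [:p $ 2, u $ 2:] ^ j)"
  have "eval2 f w = (\<Sum>j\<le>degree f. poly (coeff f j) (w $ 1) * (w $ 2) ^ j)" for w
    unfolding eval2_def by (subst poly_altdef[of f]) (simp add: poly_sum)
  then show "poly q t = eval2 f (p + t *\<^sub>R u)" for t
    by (simp add: q_def poly_sum poly_pcompose mult.commute)
  show "degree q \<le> total_degree f"
    unfolding q_def
  proof (rule degree_sum_le)
    fix j
    let ?c = "pcompose (coeff f j) [:p $ 1, u $ 1:]" and ?l = "[:p $ 2, u $ 2:] ^ j"
    show "degree (?c * ?l) \<le> total_degree f"
    proof (cases "coeff f j = 0")
      case False
      have "degree ?c \<le> degree (coeff f j)"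
        by (simp add: degree_pcompose)
      moreover have "degree ?l \<le> j"
        using degree_power_le[of "[:p $ 2, u $ 2:]" j] by (auto split: if_splits)
      moreover have "degree (coeff f j) + j \<le> total_degree f"
        using False by (intro le_total_degree) simp
      ultimately show ?thesis
        using degree_mult_le[of ?c ?l] by linarith
    qed simp
  qed simp
qed

section \<open>The Leibniz rule and plane geometry\<close>

lemma partial_x_mult: "partial_x (f * g) = f * partial_x g + g * partial_x f"
proof (rule poly_eqI)
  fix n
  have "coeff (partial_x (f * g)) n = (\<Sum>i\<le>n. pderiv (coeff f i * coeff g (n - i)))"
    using higher_pderiv_sum[of 1 "\<lambda>i. coeff f i * coeff g (n - i)"]
    by (simp add: partial_x_def coeff_map_poly coeff_mult)
  also have "\<dots> = coeff (f * partial_x g + partial_x f * g) n"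
    unfolding coeff_add coeff_mult
    by (simp add: partial_x_def coeff_map_poly pderiv_mult sum.distrib mult.commute)
  finally show "coeff (partial_x (f * g)) n = coeff (f * partial_x g + g * partial_x f) n"
    by (simp add: mult.commute)
qed

lemma vf_apply_mult: "vf_apply X (f * g) = f * vf_apply X g + g * vf_apply X f"
  by (simp add: vf_apply_def partial_x_mult partial_y_def pderiv_mult algebra_simps)

definition vf_eval :: "vector_field \<Rightarrow> real ^ 2 \<Rightarrow> real ^ 2" where
  "vf_eval X v = vector [eval2 (fst X) v, eval2 (snd X) v]"

text \<open>Counterclockwise rotation by a right angle: \<open>perp n\<close> directs the lines with
  normal \<open>n\<close>, and \<open>perp v \<bullet> w\<close> is the cross product of
  \<open>v\<close> and \<open>w\<close>.\<close>

definition perp :: "real ^ 2 \<Rightarrow> real ^ 2" where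
  "perp n = vector [- (n $ 2), n $ 1]"

lemma inner_vec2: "(v :: real ^ 2) \<bullet> w = v $ 1 * w $ 1 + v $ 2 * w $ 2"
  by (simp add: inner_vec_def sum_2)

lemma inner_perp [simp]: "n \<bullet> perp n = 0" "perp n \<bullet> n = 0"
  by (simp_all add: perp_def inner_vec2)

lemma perp_eq_0_iff [simp]: "perp n = 0 \<longleftrightarrow> n = 0"
  by (auto simp: perp_def vec_eq_iff forall_2)

lemma vec2_decompose: "(n \<bullet> n) *\<^sub>R w = (n \<bullet> w) *\<^sub>R n + (perp n \<bullet> w) *\<^sub>R perp n"
  by (simp add: vec_eq_iff forall_2 inner_vec2 perp_def algebra_simps)

lemma is_line_hyperplane: "n \<noteq> 0 \<Longrightarrow> is_line {v. n \<bullet> v = c}"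
  by (simp add: is_line_def affine_hyperplane)

text \<open>\<open>line_poly\<close> is a \<open>SOME\<close> choice, so only its specification is
  available; total degree 1 leaves three possibly nonzero coefficients, and they supply the normal
  and the offset.\<close>

lemma line_polyE:
  assumes "is_line L"
  obtains n :: "real ^ 2" and c where "n \<noteq> 0" "L = {v. n \<bullet> v = c}" "line_poly L = [:[:-c, n $ 1:], [:n $ 2:]:]"
proof -
  let ?\<alpha> = "line_poly L"
  have td: "total_degree ?\<alpha> = 1" and L: "L = {v. eval2 ?\<alpha> v = 0}"
    using is_line_equation_line_poly[OF assms] by (auto simp: is_line_equation_def)
  define n :: "real ^ 2" where "n = vector [coeff (coeff ?\<alpha> 0) 1, coeff (coeff ?\<alpha> 1) 0]"
  define c where "c = - coeff (coeff ?\<alpha> 0) 0"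
  have 0: "coeff (coeff ?\<alpha> j) i = 0" if "i + j > 1" for i j
    using le_total_degree[of ?\<alpha> j i] td that by fastforce
  have \<alpha>: "?\<alpha> = [:[:-c, n $ 1:], [:n $ 2:]:]"
    by (intro poly_eqI) (auto simp: n_def c_def coeff_pCons 0 split: nat.splits)
  have "n \<noteq> 0"
    using td \<alpha> total_degree_const[of "-c"] by auto
  moreover have "L = {v. n \<bullet> v = c}"
    by (subst L, subst \<alpha>) (auto simp: eval2_def inner_vec2 algebra_simps)
  ultimately show ?thesis
    using that \<alpha> by blast
qed

lemma lineE:
  assumes "is_line L"
  obtains n c where "n \<noteq> 0" "L = {v. n \<bullet> v = c}"
  using line_polyE[OF assms] by blast

lemma line_parametrization:
  assumes "n \<noteq> 0"
  obtains p where "\<And>t. n \<bullet> (p + t *\<^sub>R perp n) = c"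
    "\<And>v. n \<bullet> v = c \<Longrightarrow> \<exists>t. v = p + t *\<^sub>R perp n"
proof
  define p where "p = (c / (n \<bullet> n)) *\<^sub>R n"
  show "n \<bullet> (p + t *\<^sub>R perp n) = c" for t
    using assms by (simp add: p_def inner_add_right)
  show "\<exists>t. v = p + t *\<^sub>R perp n" if "n \<bullet> v = c" for v
  proof
    have "v = (1 / (n \<bullet> n)) *\<^sub>R ((n \<bullet> n) *\<^sub>R v)"
      using assms by simp
    also have "\<dots> = p + (perp n \<bullet> v / (n \<bullet> n)) *\<^sub>R perp n"
      by (subst vec2_decompose) (simp add: that p_def scaleR_add_right)
    finally show "v = p + (perp n \<bullet> v / (n \<bullet> n)) *\<^sub>R perp n" .
  qed
qed

text \<open>The direction \<open>perp n\<close> of the common line is orthogonal to both normals, so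
  they are proportional.\<close>

lemma normal_unique:
  fixes n n' :: "real ^ 2"
  assumes "n \<noteq> 0" "n' \<noteq> 0" "{v. n \<bullet> v = c} = {v. n' \<bullet> v = c'}"
  obtains k where "k \<noteq> 0" "n' = k *\<^sub>R n"
proof -
  obtain p where p: "\<And>t. n \<bullet> (p + t *\<^sub>R perp n) = c"
    using line_parametrization[OF assms(1)] by metis
  have "n' \<bullet> (p + t *\<^sub>R perp n) = c'" for t
    using p[of t] assms(3) by blast
  from this[of 0] this[of 1] have "perp n \<bullet> n' = 0"
    by (simp add: inner_add_right inner_commute)
  then have "(n \<bullet> n) *\<^sub>R n' = (n \<bullet> n') *\<^sub>R n"
    using vec2_decompose[of n n'] by simp
  then have "(1 / (n \<bullet> n)) *\<^sub>R ((n \<bullet> n) *\<^sub>R n') = (1 / (n \<bullet> n)) *\<^sub>R ((n \<bullet> n') *\<^sub>R n)"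
    by simp
  then have "n' = (n \<bullet> n' / (n \<bullet> n)) *\<^sub>R n"
    using assms(1) by simp
  with assms(2) show ?thesis
    by (metis that scale_zero_left)
qed

lemma line_subset_eq: "is_line L \<Longrightarrow> is_line L' \<Longrightarrow> L \<subseteq> L' \<Longrightarrow> L = L'"
  unfolding is_line_def by (metis affine_dim_equal aff_dim_empty one_neq_neg_one)

text \<open>Two distinct common points would span a line contained in both.\<close>

lemma finite_Int_lines:
  assumes "is_line L" "is_line L'" "L \<noteq> L'"
  shows "finite (L \<inter> L')"
proof (rule ccontr)
  assume inf: "infinite (L \<inter> L')"
  then obtain p where p: "p \<in> L \<inter> L'"
    by (metis ex_in_conv finite.emptyI)
  from inf have "infinite (L \<inter> L' - {p})"
    by simp
  then obtain q where q: "q \<in> L \<inter> L'" "q \<noteq> p"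
    by (metis DiffD1 DiffD2 ex_in_conv finite.emptyI singletonI)
  have l: "is_line (affine hull {p, q})"
    using q by (simp add: is_line_def aff_dim_2)
  have "affine hull {p, q} \<subseteq> L" "affine hull {p, q} \<subseteq> L'"
    using assms p q unfolding is_line_def by (intro hull_minimal; blast)+
  then show False
    using line_subset_eq[OF l] assms by metis
qed

section \<open>Divisibility by a linear polynomial, and invariance as tangency\<close>

lemma poly_poly_const:
  fixes f :: poly2
  shows "poly (poly f h) x = poly (poly f [:poly h x:]) x"
  by (induction f) simp_all

text \<open>A Nullstellensatz for one line. A non-vertical line is the graph y = h(x), so
  \<open>h\<close> is a root of \<open>f\<close> as a polynomial in y; for a vertical line the
  divisibility is checked coefficient by coefficient.\<close>

lemma linear_dvdI:
  fixes n :: "real ^ 2"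
  assumes n: "n \<noteq> 0" and f: "\<And>v. n \<bullet> v = c \<Longrightarrow> eval2 f v = 0"
  shows "[:[:-c, n $ 1:], [:n $ 2:]:] dvd f"
proof (cases "n $ 2 = 0")
  case False
  define h where "h = [:c / n $ 2, - (n $ 1 / n $ 2):]"
  have "poly (poly f h) x = 0" for x
  proof -
    have "eval2 f (vector [x, poly h x]) = 0"
      using False by (intro f) (simp add: inner_vec2 h_def field_simps)
    then show ?thesis
      by (simp add: eval2_def poly_poly_const[of f h x])
  qed
  then have "poly f h = 0"
    by (metis poly_all_0_iff_0)
  then obtain k where k: "f = [:-h, 1:] * k"
    by (auto simp: poly_eq_0_iff_dvd)
  \<comment> \<open>The linear polynomial is y - h(x) times a nonzero constant, hence times a
    unit.\<close>
  have "[:[:-c, n $ 1:], [:n $ 2:]:] = smult [:n $ 2:] [:-h, 1:]"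
    using False by (simp add: h_def)
  then have "[:[:-c, n $ 1:], [:n $ 2:]:] * smult [:1 / n $ 2:] k =
      smult ([:n $ 2:] * [:1 / n $ 2:]) ([:-h, 1:] * k)"
    by (simp only: mult_smult_left mult_smult_right smult_smult mult.commute)
  also have "[:n $ 2:] * [:1 / n $ 2:] = 1"
    using False by (simp add: one_pCons)
  finally show ?thesis
    by (metis dvdI k smult_1_left)
next
  case True
  with n have n1: "n $ 1 \<noteq> 0"
    by (auto simp: vec_eq_iff forall_2)
  \<comment> \<open>Fixing x first leaves a polynomial in y, which vanishes identically when x is
    the abscissa of the vertical line.\<close>
  have ev: "poly (poly p [:y:]) x = poly (map_poly (\<lambda>q. poly q x) p) y" for x y and p :: poly2
    by (induction p) (simp_all add: map_poly_pCons)
  have "poly (map_poly (\<lambda>q. poly q (c / n $ 1)) f) y = 0" for y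
    using f[of "vector [c / n $ 1, y]"] True n1 by (simp add: inner_vec2 eval2_def ev)
  then have "map_poly (\<lambda>q. poly q (c / n $ 1)) f = 0"
    by (metis poly_all_0_iff_0)
  then have "poly (coeff f j) (c / n $ 1) = 0" for j
    by (metis coeff_0 coeff_map_poly poly_0)
  then have "[:- (c / n $ 1), 1:] dvd coeff f j" for j
    by (simp add: poly_eq_0_iff_dvd)
  moreover have "[:-c, n $ 1:] = smult (n $ 1) [:- (c / n $ 1), 1:]"
    using n1 by simp
  ultimately have "[:-c, n $ 1:] dvd coeff f j" for j
    using n1 by (simp only: smult_dvd_iff) simp
  then show ?thesis
    using True by (simp add: const_poly_dvd_iff)
qed

lemma vf_apply_linear:
  fixes n :: "real ^ 2"
  shows
  "eval2 (vf_apply X [:[:-c, n $ 1:], [:n $ 2:]:]) v = n \<bullet> vf_eval X v"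
  by (simp add: vf_apply_def partial_x_def partial_y_def map_poly_pCons pderiv_pCons eval2_def
      vf_eval_def inner_vec2 mult.commute)

lemma eval2_linear:
  fixes n :: "real ^ 2"
  shows "eval2 [:[:-c, n $ 1:], [:n $ 2:]:] v = n \<bullet> v - c"
  by (simp add: eval2_def inner_vec2 algebra_simps)

text \<open>Replaces the chosen equation by an arbitrary normal: the two normals differ by a nonzero
  factor, which does not affect tangency.\<close>

lemma invariant_line_iff:
  assumes "n \<noteq> 0"
  shows "invariant_line X {v. n \<bullet> v = c} \<longleftrightarrow> (\<forall>v. n \<bullet> v = c \<longrightarrow> n \<bullet> vf_eval X v = 0)"
proof -
  let ?L = "{v. n \<bullet> v = c}"
  obtain n' c' where n': "n' \<noteq> 0" "?L = {v. n' \<bullet> v = c'}"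
    and lp: "line_poly ?L = [:[:-c', n' $ 1:], [:n' $ 2:]:]"
    using line_polyE[OF is_line_hyperplane[OF assms]] by metis
  obtain k where k: "k \<noteq> 0" "n' = k *\<^sub>R n"
    using normal_unique[OF assms n'] by metis
  have mem: "n' \<bullet> v = c' \<longleftrightarrow> n \<bullet> v = c" for v
    using n'(2) by blast
  have "line_poly ?L dvd vf_apply X (line_poly ?L) \<longleftrightarrow> (\<forall>v. n' \<bullet> v = c' \<longrightarrow> n' \<bullet> vf_eval X v = 0)"
    unfolding lp
  proof
    assume "[:[:-c', n' $ 1:], [:n' $ 2:]:] dvd vf_apply X [:[:-c', n' $ 1:], [:n' $ 2:]:]"
    then obtain g where
      "vf_apply X [:[:-c', n' $ 1:], [:n' $ 2:]:] = [:[:-c', n' $ 1:], [:n' $ 2:]:] * g" ..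
    then have "n' \<bullet> vf_eval X v = (n' \<bullet> v - c') * eval2 g v" for v
      by (metis vf_apply_linear eval2_linear eval2_simps(5))
    then show "\<forall>v. n' \<bullet> v = c' \<longrightarrow> n' \<bullet> vf_eval X v = 0"
      by simp
  next
    assume "\<forall>v. n' \<bullet> v = c' \<longrightarrow> n' \<bullet> vf_eval X v = 0"
    then show "[:[:-c', n' $ 1:], [:n' $ 2:]:] dvd vf_apply X [:[:-c', n' $ 1:], [:n' $ 2:]:]"
      using n'(1) by (intro linear_dvdI) (simp_all add: vf_apply_linear)
  qed
  also have "\<dots> \<longleftrightarrow> (\<forall>v. n \<bullet> v = c \<longrightarrow> n \<bullet> vf_eval X v = 0)"
    unfolding mem using k by simp
  finally show ?thesis
    using is_line_hyperplane[OF assms, of c] by (simp add: invariant_line_def)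
qed

section \<open>Primality of line ideals, and invariance of the lines of an arrangement\<close>

text \<open>Restriction to a line lands in univariate polynomials, which have no zero
  divisors.\<close>

lemma zero_on_line_mult:
  assumes L: "is_line L" and fg: "\<And>v. v \<in> L \<Longrightarrow> eval2 f v * eval2 g v = 0"
  shows "(\<forall>v\<in>L. eval2 f v = 0) \<or> (\<forall>v\<in>L. eval2 g v = 0)"
proof -
  obtain n c where n: "n \<noteq> 0" "L = {v. n \<bullet> v = c}"
    using lineE[OF L] by metis
  obtain p where p: "\<And>t. n \<bullet> (p + t *\<^sub>R perp n) = c"
    "\<And>v. n \<bullet> v = c \<Longrightarrow> \<exists>t. v = p + t *\<^sub>R perp n"
    using line_parametrization[OF n(1)] by metis
  obtain q where q: "\<And>t. poly q t = eval2 f (p + t *\<^sub>R perp n)"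
    using eval2_along_line by metis
  obtain r where r: "\<And>t. poly r t = eval2 g (p + t *\<^sub>R perp n)"
    using eval2_along_line by metis
  have "poly (q * r) t = 0" for t
    using fg[of "p + t *\<^sub>R perp n"] p(1) n by (simp add: q r)
  then have "q * r = 0"
    by (metis poly_all_0_iff_0)
  then have "(\<forall>t. eval2 f (p + t *\<^sub>R perp n) = 0) \<or> (\<forall>t. eval2 g (p + t *\<^sub>R perp n) = 0)"
    by (metis mult_eq_0_iff poly_0 q r)
  then show ?thesis
    using p(2) n(2) by blast
qed

lemma zero_on_line_prod:
  assumes "is_line L" "finite I" "\<And>v. v \<in> L \<Longrightarrow> (\<Prod>i\<in>I. eval2 (f i) v) = 0"
  shows "\<exists>i\<in>I. \<forall>v\<in>L. eval2 (f i) v = 0"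
  using assms(2,3)
proof (induction I rule: finite_induct)
  case empty
  have "L \<noteq> {}"
    using assms(1) by (auto simp: is_line_def)
  with empty show ?case
    by force
next
  case (insert i I)
  have "(\<forall>v\<in>L. eval2 (f i) v = 0) \<or> (\<forall>v\<in>L. eval2 (\<Prod>i\<in>I. f i) v = 0)"
    using insert by (intro zero_on_line_mult[OF assms(1)]) (simp add: eval2_prod)
  then show ?case
    using insert.IH by (auto simp: eval2_prod)
qed

lemma zero_on_line_lines:
  assumes "is_line L" "finite \<A>" "\<And>L'. L' \<in> \<A> \<Longrightarrow> is_line L'"
    and "\<And>v. v \<in> L \<Longrightarrow> eval2 (\<Prod>L'\<in>\<A>. line_poly L') v = 0"
  shows "L \<in> \<A>"
proof -
  obtain L' where L': "L' \<in> \<A>" "\<forall>v\<in>L. eval2 (line_poly L') v = 0"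
    using zero_on_line_prod[OF assms(1,2)] assms(4) by (force simp: eval2_prod)
  then have "L \<subseteq> L'"
    using is_line_equation_line_poly[OF assms(3)[OF L'(1)]] by (auto simp: is_line_equation_def)
  then show ?thesis
    using line_subset_eq[OF assms(1) assms(3)[OF L'(1)]] L'(1) by simp
qed

text \<open>By the Leibniz rule, the product of \<open>R\<close> and
  \<open>vf_apply X (line_poly L)\<close> vanishes on \<open>L\<close>. The cofactor
  \<open>R\<close> cannot vanish there, as it collects only the other lines.\<close>

lemma derivations_invariant:
  assumes A: "line_arrangement \<A>" and X: "X \<in> derivations \<A>" and L: "L \<in> \<A>"
  shows "invariant_line X L"
proof -
  have lines: "finite \<A>" "\<And>L. L \<in> \<A> \<Longrightarrow> is_line L"
    using A by (auto simp: line_arrangement_def)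
  obtain n c where n: "n \<noteq> 0" "L = {v. n \<bullet> v = c}"
    and lp: "line_poly L = [:[:-c, n $ 1:], [:n $ 2:]:]"
    using line_polyE[OF lines(2)[OF L]] by metis
  define R where "R = (\<Prod>L'\<in>\<A> - {L}. line_poly L')"
  have "defining_poly \<A> = line_poly L * R"
    using lines(1) L by (simp add: defining_poly_def R_def prod.remove)
  then have "line_poly L * R dvd line_poly L * vf_apply X R + R * vf_apply X (line_poly L)"
    using X by (simp add: derivations_def vf_apply_mult)
  then obtain g where
    g: "line_poly L * vf_apply X R + R * vf_apply X (line_poly L) = line_poly L * R * g" ..
  have "eval2 R v * eval2 (vf_apply X (line_poly L)) v = 0" if "v \<in> L" for v
  proof -
    have "n \<bullet> v = c"
      using that n(2) by blast
    then have "eval2 (line_poly L) v = 0"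
      by (simp add: lp eval2_linear)
    then show ?thesis
      using arg_cong[OF g, of "\<lambda>p. eval2 p v"] by simp
  qed
  then consider "\<forall>v\<in>L. eval2 R v = 0" | "\<forall>v\<in>L. eval2 (vf_apply X (line_poly L)) v = 0"
    using zero_on_line_mult[OF lines(2)[OF L]] by blast
  then show ?thesis
  proof cases
    case 1
    then have "L \<in> \<A> - {L}"
      using lines L by (intro zero_on_line_lines) (auto simp: R_def)
    then show ?thesis
      by simp
  next
    case 2
    then have "\<forall>v\<in>L. n \<bullet> vf_eval X v = 0"
      by (simp add: lp vf_apply_linear)
    then show ?thesis
      using invariant_line_iff[OF n(1)] by (simp add: n(2))
  qed
qed

section \<open>A derivation with finitely many invariant lines\<close>

text \<open>A field without invariant lines, multiplied by \<open>defining_poly \<A>\<close>,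
  becomes a derivation whose invariant lines all lie in \<open>\<A>\<close>.\<close>

lemma ex_derivation_finite_invariant:
  assumes A: "line_arrangement \<A>"
  shows "\<exists>X\<in>derivations \<A>. finite {L. invariant_line X L}"
proof
  have lines: "finite \<A>" "\<And>L. L \<in> \<A> \<Longrightarrow> is_line L"
    using A by (auto simp: line_arrangement_def)
  \<comment> \<open>The field \<open>\<partial>\<^sub>x + x \<partial>\<^sub>y\<close> has no invariant line, its orbits being parabolas.\<close>
  define X :: vector_field where "X = (defining_poly \<A>, defining_poly \<A> * [:[:0, 1:]:])"
  show "X \<in> derivations \<A>"
    unfolding X_def derivations_def vf_apply_def fst_conv snd_conv mem_Collect_eq mult.assoc
    by (intro dvd_add dvd_triv_left)
  have "L \<in> \<A>" if inv: "invariant_line X L" for L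
  proof -
    have L: "is_line L"
      using inv by (simp add: invariant_line_def)
    then obtain n c where n: "n \<noteq> 0" "L = {v. n \<bullet> v = c}"
      using lineE by metis
    let ?g = "[:[:n $ 1, n $ 2:]:] :: poly2"
    have "eval2 (defining_poly \<A>) v * eval2 ?g v = 0" if "v \<in> L" for v
      using inv that invariant_line_iff[OF n(1), of X c]
      by (simp add: n X_def vf_eval_def inner_vec2 eval2_def algebra_simps)
    then consider "\<forall>v\<in>L. eval2 (defining_poly \<A>) v = 0" | "\<forall>v\<in>L. eval2 ?g v = 0"
      using zero_on_line_mult[OF L] by blast
    then show ?thesis
    proof cases
      case 1
      then show ?thesis
        using zero_on_line_lines[OF L lines] by (simp add: defining_poly_def)
    next
      case 2
      obtain p where p: "\<And>t. n \<bullet> (p + t *\<^sub>R perp n) = c"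
        using line_parametrization[OF n(1)] by metis
      have "eval2 ?g (p + t *\<^sub>R perp n) = 0" for t
        using 2 p[of t] n by blast
      \<comment> \<open>The two values differ by the square of \<open>n $ 2\<close>, so
        \<open>n $ 2 = 0\<close>, and then \<open>?g\<close> is the constant
        \<open>n $ 1\<close>.\<close>
      from this[of 0] this[of 1] have "n = 0"
        by (simp add: eval2_def perp_def vec_eq_iff forall_2 algebra_simps)
      with n show ?thesis
        by simp
    qed
  qed
  then show "finite {L. invariant_line X L}"
    using lines(1) by (auto intro: finite_subset)
qed

section \<open>Polynomials vanishing on many lines\<close>

text \<open>Among the vectors (1, s), each nonzero \<open>e\<close> is orthogonal to at most
  one.\<close>

lemma ex_transversal:
  fixes E :: "(real ^ 2) set"
  assumes "finite E" "0 \<notin> E"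
  obtains u where "\<And>e. e \<in> E \<Longrightarrow> e \<bullet> u \<noteq> 0"
proof -
  \<comment> \<open>For \<open>e $ 2 = 0\<close> the quotient is 0 by convention, which merely
    excludes one more value of \<open>s\<close>.\<close>
  obtain s where s: "s \<notin> (\<lambda>e. - (e $ 1 / e $ 2)) ` E"
    using ex_new_if_finite[OF infinite_UNIV_char_0 finite_imageI[OF assms(1)]] by blast
  have "e \<bullet> vector [1, s] \<noteq> 0" if "e \<in> E" for e
  proof (cases "e $ 2 = 0")
    case True
    moreover have "e \<noteq> 0"
      using that assms(2) by blast
    ultimately show ?thesis
      by (auto simp: inner_vec2 vec_eq_iff forall_2)
  next
    case False
    have "s \<noteq> - (e $ 1 / e $ 2)"
      using s that by blast
    with False show ?thesis
      by (simp add: inner_vec2 field_simps)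
  qed
  then show ?thesis
    using that by blast
qed

text \<open>
  A generic line through \<open>z\<close> meets the given lines in pairwise distinct points, which are
  too many roots for the restriction of \<open>f\<close> to it.
\<close>

lemma eval2_eq_0_of_lines:
  assumes S: "finite S" "\<And>L. L \<in> S \<Longrightarrow> is_line L"
    and f: "\<And>L v. L \<in> S \<Longrightarrow> v \<in> L \<Longrightarrow> eval2 f v = 0"
    and deg: "total_degree f < card S"
  shows "eval2 f z = 0"
proof (rule ccontr)
  assume z: "eval2 f z \<noteq> 0"
  have "\<forall>L\<in>S. \<exists>n c. n \<noteq> 0 \<and> L = {v. n \<bullet> v = c}"
    using lineE[OF S(2)] by metis
  then obtain N C where NC: "\<And>L. L \<in> S \<Longrightarrow> N L \<noteq> 0 \<and> L = {v. N L \<bullet> v = C L}"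
    by metis
  define W where "W = (\<Union>L\<in>S. \<Union>L'\<in>S - {L}. L \<inter> L')"
  have "finite W"
    using S unfolding W_def by (intro finite_UN_I finite_Diff finite_Int_lines) auto
  have "z \<notin> W"
    using z f by (auto simp: W_def)
  then have "0 \<notin> (\<lambda>w. perp (w - z)) ` W"
    by (metis (no_types, lifting) eq_iff_diff_eq_0 image_iff perp_eq_0_iff)
  moreover have "0 \<notin> N ` S"
    using NC by (metis image_iff)
  \<comment> \<open>The vectors \<open>N L\<close> make direction \<open>u\<close> meet every line
    of \<open>S\<close>; the vectors \<open>perp (w - z)\<close> keep the line through
    \<open>z\<close> away from the crossing points in \<open>W\<close>.\<close>
  ultimately obtain u where u: "\<And>e. e \<in> N ` S \<union> (\<lambda>w. perp (w - z)) ` W \<Longrightarrow> e \<bullet> u \<noteq> 0"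
    using ex_transversal[of "N ` S \<union> (\<lambda>w. perp (w - z)) ` W"] S(1) \<open>finite W\<close>
    by (metis Un_iff finite_UnI finite_imageI)
  define t where "t L = (C L - N L \<bullet> z) / (N L \<bullet> u)" for L
  have t: "z + t L *\<^sub>R u \<in> L" if "L \<in> S" for L
  proof -
    have "N L \<bullet> (z + t L *\<^sub>R u) = C L"
      using u[of "N L"] that by (simp add: t_def inner_add_right)
    then show ?thesis
      using NC[OF that] by blast
  qed
  have "inj_on t S"
  proof (rule inj_onI, rule ccontr)
    fix L L'
    assume LL': "L \<in> S" "L' \<in> S" "t L = t L'" "L \<noteq> L'"
    then have "z + t L *\<^sub>R u \<in> W"
      using t[of L] t[of L'] by (auto simp: W_def)
    then have "perp (z + t L *\<^sub>R u - z) \<bullet> u \<noteq> 0"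
      by (intro u) blast
    then show False
      by (simp add: perp_def inner_vec2)
  qed
  obtain q where q: "\<And>t. poly q t = eval2 f (z + t *\<^sub>R u)" "degree q \<le> total_degree f"
    using eval2_along_line by metis
  have "q \<noteq> 0"
    using q(1)[of 0] z by auto
  have "card S = card (t ` S)"
    using \<open>inj_on t S\<close> by (simp add: card_image)
  also have "\<dots> \<le> card {s. poly q s = 0}"
    using t f \<open>q \<noteq> 0\<close> by (intro card_mono poly_roots_finite) (auto simp: q(1))
  also have "\<dots> \<le> degree q"
    by (rule card_poly_roots_bound) fact
  finally show False
    using q(2) deg by simp
qed

section \<open>Too many parallel or concurrent lines force infinitely many invariant lines\<close>

lemma infinite_invariant_parallel:
  assumes A: "line_arrangement \<A>" and X: "X \<in> derivations \<A>"
    and B: "B \<subseteq> \<A>" "pairwise affine_parallel B" "vf_degree X < card B"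
  shows "infinite {L. invariant_line X L}"
proof -
  have lines: "finite B" "\<And>L. L \<in> B \<Longrightarrow> is_line L"
    using A B(1) by (auto simp: line_arrangement_def intro: finite_subset)
  obtain L0 where L0: "L0 \<in> B"
    using B(3) by fastforce
  obtain n c0 where n: "n \<noteq> 0" "L0 = {v. n \<bullet> v = c0}"
    using lineE[OF lines(2)[OF L0]] by metis
  have par: "\<exists>c. L = {v. n \<bullet> v = c}" if "L \<in> B" for L
  proof (cases "L = L0")
    case False
    then have "affine_parallel L0 L"
      using B(2) L0 that by (metis pairwiseD)
    then obtain a where a: "L = (\<lambda>x. a + x) ` L0"
      by (auto simp: affine_parallel_def)
    have "L = {v. n \<bullet> v = n \<bullet> a + c0}"
    proof (intro set_eqI iffI)
      fix v assume "v \<in> {v. n \<bullet> v = n \<bullet> a + c0}"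
      then have "v - a \<in> L0"
        by (simp add: n inner_diff_right)
      then show "v \<in> L"
        unfolding a by (rule rev_image_eqI) simp
    qed (auto simp: a n inner_add_right)
    then show ?thesis ..
  qed (use n in blast)
  define g where "g = [:[:n $ 1:]:] * fst X + [:[:n $ 2:]:] * snd X"
  have g: "eval2 g v = n \<bullet> vf_eval X v" for v
    by (simp add: g_def eval2_def vf_eval_def inner_vec2)
  \<comment> \<open>The summand 0 is the degree of the constant factors, in the shape
    \<open>total_degree_mult_le\<close> expects.\<close>
  have td: "total_degree g \<le> 0 + vf_degree X"
    unfolding g_def
    by (intro total_degree_add_le total_degree_mult_le) (simp_all add: total_degree_const vf_degree_def)
  have vanish: "eval2 g v = 0" if LB: "L \<in> B" and v: "v \<in> L" for L v
  proof -
    obtain c where c: "L = {v. n \<bullet> v = c}"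
      using par[OF LB] by blast
    have "invariant_line X L"
      using derivations_invariant[OF A X] B(1) LB by blast
    then show ?thesis
      using v invariant_line_iff[OF n(1), of X c] by (simp add: c g)
  qed
  have "eval2 g v = 0" for v
    using td B(3) by (intro eval2_eq_0_of_lines[OF lines vanish]) auto
  then have "range (\<lambda>c. {v. n \<bullet> v = c}) \<subseteq> {L. invariant_line X L}"
    using g by (auto simp: invariant_line_iff[OF n(1), of X])
  moreover have "inj (\<lambda>c. {v. n \<bullet> v = c})"
  proof (rule injI)
    fix c c' assume "{v. n \<bullet> v = c} = {v. n \<bullet> v = c'}"
    moreover have "n \<bullet> ((c / (n \<bullet> n)) *\<^sub>R n) = c"
      using n(1) by simp
    ultimately show "c = c'"
      by (metis (mono_tags, lifting) mem_Collect_eq)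
  qed
  ultimately show ?thesis
    by (meson finite_subset infinite_UNIV_char_0 finite_imageD)
qed

lemma infinite_invariant_concurrent:
  assumes A: "line_arrangement \<A>" and X: "X \<in> derivations \<A>"
    and deg: "vf_degree X + 1 < point_mult \<A> p"
  shows "infinite {L. invariant_line X L}"
proof -
  define S where "S = {L \<in> \<A>. p \<in> L}"
  have S: "finite S" "\<And>L. L \<in> S \<Longrightarrow> is_line L"
    using A by (auto simp: line_arrangement_def S_def)
  \<comment> \<open>The cross product of \<open>v - p\<close> with the field; the explicit zeros
    give both linear factors the shape of \<open>total_degree_linear_le\<close>.\<close>
  define f where "f = [:[:- (p $ 1), 1:], [:0:]:] * snd X - [:[:- (p $ 2), 0:], [:1:]:] * fst X"
  have f: "eval2 f v = perp (v - p) \<bullet> vf_eval X v" for v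
    by (simp add: f_def eval2_def vf_eval_def inner_vec2 perp_def algebra_simps)
  have td: "total_degree f \<le> 1 + vf_degree X"
    unfolding f_def
    by (intro total_degree_diff_le total_degree_mult_le total_degree_linear_le)
      (simp_all add: vf_degree_def)
  have vanish: "eval2 f v = 0" if LS: "L \<in> S" and v: "v \<in> L" for L v
  proof -
    obtain n c where n: "n \<noteq> 0" "L = {v. n \<bullet> v = c}"
      using lineE[OF S(2)[OF LS]] by metis
    have "invariant_line X L"
      using derivations_invariant[OF A X] LS by (simp add: S_def)
    then have 1: "n \<bullet> vf_eval X v = 0"
      using v invariant_line_iff[OF n(1), of X c] by (simp add: n)
    have 2: "n \<bullet> (v - p) = 0"
      using v LS n(2) by (simp add: S_def inner_diff_right)
    \<comment> \<open>Since \<open>v - p\<close> runs along the line, its cross product with the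
      field is a multiple of \<open>n \<bullet> vf_eval X v\<close>, which is 0.\<close>
    have "(n \<bullet> n) *\<^sub>R (v - p) = (perp n \<bullet> (v - p)) *\<^sub>R perp n"
      using vec2_decompose[of n "v - p"] 2 by simp
    then have "(n \<bullet> n) * eval2 f v = (perp n \<bullet> (v - p)) * (perp (perp n) \<bullet> vf_eval X v)"
      unfolding f by (simp add: vec_eq_iff forall_2 perp_def inner_vec2) algebra
    also have "perp (perp n) = - n"
      by (simp add: perp_def vec_eq_iff forall_2)
    finally show ?thesis
      using n(1) 1 by simp
  qed
  have zero: "eval2 f v = 0" for v
    using td deg
    by (intro eval2_eq_0_of_lines[OF S vanish]) (auto simp: point_mult_def S_def)
  \<comment> \<open>The non-vertical lines through \<open>p\<close>, by slope \<open>-s\<close>; on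
    each of them the first coordinate equals \<open>p $ 1\<close> only at \<open>p\<close>.\<close>
  define l where "l s = {v. (vector [s, 1] :: real ^ 2) \<bullet> v = vector [s, 1] \<bullet> p}" for s
  have "invariant_line X (l s)" for s
  proof -
    define n :: "real ^ 2" where "n = vector [s, 1]"
    have n: "n \<noteq> 0"
      by (auto simp: n_def vec_eq_iff forall_2)
    define g where "g = [:[:s:]:] * fst X + snd X"
    have g: "eval2 g v = n \<bullet> vf_eval X v" for v
      by (simp add: g_def eval2_def vf_eval_def inner_vec2 n_def)
    \<comment> \<open>Away from \<open>p\<close> the vector \<open>v - p\<close> is nonzero and parallel to the field; the factor
        \<open>v $ 1 - p $ 1\<close> lets the single point \<open>p\<close> be filled in by \<open>zero_on_line_mult\<close>.\<close>
    have "eval2 [:[:- (p $ 1), 1:]:] v * eval2 g v = 0" if "v \<in> l s" for v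
    proof -
      \<comment> \<open>On this line the cross product \<open>f\<close> factors as
        \<open>v $ 1 - p $ 1\<close> times \<open>g\<close>.\<close>
      have "v $ 2 - p $ 2 = - s * (v $ 1 - p $ 1)"
        using that by (simp add: l_def inner_vec2 algebra_simps)
      then show ?thesis
        using zero[of v] unfolding f g
        by (simp add: perp_def inner_vec2 n_def eval2_def) algebra
    qed
    moreover have "is_line (l s)"
      using is_line_hyperplane[OF n] by (simp add: l_def n_def)
    ultimately consider "\<forall>v\<in>l s. eval2 [:[:- (p $ 1), 1:]:] v = 0" | "\<forall>v\<in>l s. eval2 g v = 0"
      using zero_on_line_mult by blast
    then show ?thesis
    proof cases
      case 1
      \<comment> \<open>Here \<open>perp n\<close> is (-1, s), so the linear factor takes the value
        1 at this point, contradicting the case.\<close>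
      have "p - perp n \<in> l s"
        by (simp add: l_def n_def[symmetric] inner_diff_right)
      with 1 have "eval2 [:[:- (p $ 1), 1:]:] (p - perp n) = 0"
        by blast
      then show ?thesis
        by (simp add: eval2_def perp_def n_def)
    next
      case 2
      then show ?thesis
        using invariant_line_iff[OF n, of X "n \<bullet> p"] by (simp add: g l_def n_def)
    qed
  qed
  then have "range l \<subseteq> {L. invariant_line X L}"
    by auto
  moreover have "inj l"
  proof (rule injI)
    fix s s' assume "l s = l s'"
    moreover have "p + vector [1, -s] \<in> l s"
      by (simp add: l_def inner_vec2 algebra_simps)
    ultimately have "p + vector [1, -s] \<in> l s'"
      by simp
    then show "s = s'"
      by (simp add: l_def inner_vec2 algebra_simps)
  qed
  ultimately show ?thesis
    by (meson finite_subset infinite_UNIV_char_0 finite_imageD)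
qed

section \<open>Attained maxima and the final bound\<close>

lemma max_parallel_attained:
  assumes "finite \<A>"
  obtains B where "B \<subseteq> \<A>" "pairwise affine_parallel B" "card B = max_parallel \<A>"
proof -
  let ?P = "{card B |B. B \<subseteq> \<A> \<and> pairwise affine_parallel B}"
  have "?P \<subseteq> card ` Pow \<A>"
    by auto
  then have "finite ?P"
    using assms by (simp add: finite_subset)
  moreover have "card {} \<in> ?P"
    by force
  ultimately have "max_parallel \<A> \<in> ?P"
    unfolding max_parallel_def by (intro Max_in) auto
  then show ?thesis
    using that by auto
qed

lemma max_mult_attained:
  assumes "finite \<A>" "max_mult \<A> > 1"
  obtains p where "point_mult \<A> p = max_mult \<A>"
proof -
  \<comment> \<open>Without singular points \<open>max_mult\<close> would take its default value
    1.\<close>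
  have ne: "singular_points \<A> \<noteq> {}"
    using assms(2) by (auto simp: max_mult_def)
  have "point_mult \<A> p \<le> card \<A>" for p
    using assms(1) by (auto simp: point_mult_def intro: card_mono)
  then have "finite (point_mult \<A> ` singular_points \<A>)"
    by (auto intro: finite_subset[of _ "{..card \<A>}"])
  then have "max_mult \<A> \<in> point_mult \<A> ` singular_points \<A>"
    using ne by (simp add: max_mult_def)
  then show ?thesis
    using that by auto
qed

theorem corollary3p8:
  fixes \<A> :: "(real ^ 2) set set"
  assumes "line_arrangement \<A>"
  shows "d_f \<A> \<ge> nu_infinity \<A>"
proof -
  have fin: "finite \<A>"
    using assms by (simp add: line_arrangement_def)
  have "\<exists>d. \<exists>X\<in>derivations \<A>. finite {L. invariant_line X L} \<and> vf_degree X = d"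
    using ex_derivation_finite_invariant[OF assms] by blast
  from LeastI_ex[OF this] obtain X where X: "X \<in> derivations \<A>"
    and inv: "finite {L. invariant_line X L}" and deg: "vf_degree X = d_f \<A>"
    unfolding d_f_def by blast
  obtain B where "B \<subseteq> \<A>" "pairwise affine_parallel B" "card B = max_parallel \<A>"
    using max_parallel_attained[OF fin] .
  then have "max_parallel \<A> \<le> d_f \<A>"
    using infinite_invariant_parallel[OF assms X, of B] inv deg by fastforce
  moreover have "max_mult \<A> - 1 \<le> d_f \<A>"
  proof (cases "max_mult \<A> > 1")
    case True
    then obtain p where "point_mult \<A> p = max_mult \<A>"
      using max_mult_attained[OF fin] by blast
    then show ?thesis
      using infinite_invariant_concurrent[OF assms X, of p] inv deg by fastforce
  qed simp
  ultimately show ?thesis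
    by (simp add: nu_infinity_def)
qed

end
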